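(* Let a dominated model $\mathscr{P}$ and a prior $\Pi$ be given, let $X_1,X_2,\ldots$ be i.i.d.-$P_0$, and assume that $P_0^n\ll P_n^\Pi$ for all $n\geq1$. Let $V$ be a (measurable) model subset, with a countable cover $V_1,V_2,\ldots$ by model subsets, and let $B_1,B_2,\ldots$ be model subsets such that for all $i\geq1$, $\Pi(B_i)>0$ and for all $P\in V_i$, $\sup_{Q\in B_i}P_0(dP/dQ)<\infty$. Then, for every $n\geq 1$, \[ P_0^n\,\Pi(V\mid X_1,\ldots,X_n)\leq\sum_{i\geq1}\ \inf_{0\leq\alpha\leq1}\frac{\Pi(V_i)^\alpha}{\Pi(B_i)^\alpha}\,\pi_{P_0}\bigl(\mathrm{co}(V_i),B_i;\alpha\bigr)^n. \]
   Context: Setting. $(\mathscr{X},\mathscr{A})$ is a measurable space (the sample space). The model $\mathscr{P}$ is a collection of probability measures on $(\mathscr{X},\mathscr{A})$ dominated by a $\sigma$-finite measure $\mu$, with densities $p=dP/d\mu$; it carries a $\sigma$-algebra $\mathscr{B}$ such that $P\mapsto P(A)$ is measurable for every $A\in\mathscr{A}$ (densities are taken measurable in $(x,P)$, and model subsets to which $\Pi$ is applied are measurable). The prior $\Pi$ is a probability measure on $(\mathscr{P},\mathscr{B})$; $P_0$ is a probability measure on $(\mathscr{X},\mathscr{A})$. Notation: $P_0f=\int f\,dP_0$, so $P_0^n\Pi(V\mid X_1,\ldots,X_n)$ is the $P_0^n$-expectation of the posterior mass. The prior predictive distributions are $P_n^\Pi(A)=\int P^n(A)\,d\Pi(P)$.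 The posterior is \[ \Pi(A\mid X_1,\ldots,X_n)=\int_A\prod_{i=1}^n p(X_i)\,d\Pi(P)\Bigm/\int_{\mathscr{P}}\prod_{i=1}^n p(X_i)\,d\Pi(P). \] $\mathrm{co}(V)$ is the convex hull of $V$. For $\alpha\in[0,1]$ and sets $W,B$ of probability measures, $\pi_{P_0}(W,B;\alpha)=\sup_{P\in W}\sup_{Q\in B}P_0(dP/dQ)^\alpha$. Conventions: $P_0(dP/dQ)^\alpha=\int_{\{p_0>0,\,p>0\}}(p/q)^\alpha\,dP_0$; finiteness of $P_0(dP/dQ)$ includes that $q>0$ $P_0$-almost everywhere on $\{p>0\}$; for $\alpha=0$ the expression equals $P_0(p>0)$. *)

theory Defs
  imports "HOL-Probability.Probability"
begin

text \<open>
  The sample space is \<open>(space \<mu>, sets \<mu>)\<close>. A prior is a measure on a type of measures: its space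
  is the model and its \<open>\<sigma>\<close>-algebra is the one carried by the model. \<open>p P\<close> is a version of the
  density of \<open>P\<close> with respect to \<open>\<mu>\<close>.
\<close>

locale dominated_model =
  \<mu>: sigma_finite_measure \<mu> + prior: prob_space prior
  for \<mu> :: "'a measure" and prior :: "'a measure measure" +
  fixes p :: "'a measure \<Rightarrow> 'a \<Rightarrow> ennreal"
  assumes model_prob_space: "P \<in> space prior \<Longrightarrow> prob_space P"
    and model_sets: "P \<in> space prior \<Longrightarrow> sets P = sets \<mu>"
    and model_eval_measurable: "A \<in> sets \<mu> \<Longrightarrow> (\<lambda>P. emeasure P A) \<in> borel_measurable prior"
    and model_density: "P \<in> space prior \<Longrightarrow> density \<mu> (p P) = P"
    and density_measurable: "(\<lambda>(x, P). p P x) \<in> borel_measurable (\<mu> \<Otimes>\<^sub>M prior)"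

definition iid_product :: "nat \<Rightarrow> 'a measure \<Rightarrow> (nat \<Rightarrow> 'a) measure" where
  "iid_product n P = PiM {..<n} (\<lambda>_. P)"

definition prior_predictive ::
    "'a measure \<Rightarrow> 'a measure measure \<Rightarrow> nat \<Rightarrow> (nat \<Rightarrow> 'a) measure" where
  "prior_predictive \<mu> prior n =
     measure_of (space (iid_product n \<mu>)) (sets (iid_product n \<mu>))
       (\<lambda>A. \<integral>\<^sup>+ P. emeasure (iid_product n P) A \<partial>prior)"

definition posterior ::
    "'a measure measure \<Rightarrow> ('a measure \<Rightarrow> 'a \<Rightarrow> ennreal) \<Rightarrow> nat \<Rightarrow> 'a measure set \<Rightarrow>
      (nat \<Rightarrow> 'a) \<Rightarrow> ennreal" where
  "posterior prior p n A x =
     (\<integral>\<^sup>+ P\<in>A. (\<Prod>i<n. p P (x i)) \<partial>prior) / (\<integral>\<^sup>+ P. (\<Prod>i<n. p P (x i)) \<partial>prior)"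

text \<open>Real powers on \<open>[0, \<infinity>]\<close>, with \<open>0\<^sup>0 = 1\<close> (unlike \<open>powr\<close>, where \<open>0 powr 0 = 0\<close>) and \<open>\<infinity>\<^sup>0 = 1\<close>.\<close>

definition ennpow :: "ennreal \<Rightarrow> real \<Rightarrow> ennreal" where
  "ennpow x \<alpha> =
     (if \<alpha> = 0 then 1 else if x = \<infinity> then \<infinity> else ennreal (enn2real x powr \<alpha>))"

text \<open>
  \<open>P\<^sub>0 (dP/dQ)\<^sup>\<alpha>\<close>, where \<open>p\<^sub>0\<close>, \<open>p\<close>, \<open>q\<close> are the densities with respect to \<open>\<mu>\<close>. Since \<open>a / 0 = \<infinity>\<close> in
  \<^typ>\<open>ennreal\<close> for \<open>a > 0\<close>, finiteness for \<open>\<alpha> > 0\<close> entails that \<open>q > 0\<close> holds \<open>P\<^sub>0\<close>-almost everywhere on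
  \<open>{p\<^sub>0 > 0, p > 0}\<close>; for \<open>\<alpha> = 0\<close> the value is the \<open>P\<^sub>0\<close>-mass of that set.
\<close>

definition ratio_moment ::
    "'a measure \<Rightarrow> 'a measure \<Rightarrow> 'a measure \<Rightarrow> 'a measure \<Rightarrow> real \<Rightarrow> ennreal" where
  "ratio_moment \<mu> P0 P Q \<alpha> =
     (\<integral>\<^sup>+ x\<in>{x \<in> space \<mu>. RN_deriv \<mu> P0 x > 0 \<and> RN_deriv \<mu> P x > 0}.
        ennpow (RN_deriv \<mu> P x / RN_deriv \<mu> Q x) \<alpha> \<partial>P0)"

definition pi_sup ::
    "'a measure \<Rightarrow> 'a measure \<Rightarrow> 'a measure set \<Rightarrow> 'a measure set \<Rightarrow> real \<Rightarrow> ennreal" where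
  "pi_sup \<mu> P0 W B \<alpha> = (SUP P\<in>W. SUP Q\<in>B. ratio_moment \<mu> P0 P Q \<alpha>)"

text \<open>
  Measures do not form a real vector space in the library, so the convex hull is spelled out as
  the set of all finite convex combinations.
\<close>

definition co :: "'a measure \<Rightarrow> 'a measure set \<Rightarrow> 'a measure set" where
  "co \<mu> W = {R. sets R = sets \<mu> \<and>
     (\<exists>(k::nat) (w :: nat \<Rightarrow> real) (P :: nat \<Rightarrow> 'a measure).
        (\<forall>j<k. P j \<in> W \<and> 0 \<le> w j) \<and> (\<Sum>j<k. w j) = 1 \<and>
        (\<forall>A\<in>sets \<mu>. emeasure R A = (\<Sum>j<k. ennreal (w j) * emeasure (P j) A)))}"

end

theory Submission
  imports Defs
begin

text \<open>
  The posterior mass of \<open>V\<^sub>i\<close> is at most one and at most the ratio of the integrals of the likelihood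
  over \<open>V\<^sub>i\<close> and \<open>B\<^sub>i\<close>, hence at most the \<open>\<alpha>\<close>-th power of this ratio. Jensen's inequality for the convex
  function \<open>t \<mapsto> t powr (-\<alpha>)\<close> moves the integral over \<open>B\<^sub>i\<close> out of the power. For a fixed \<open>Q\<close> in \<open>B\<^sub>i\<close>, the
  mixture of the likelihoods over \<open>V\<^sub>i\<close> is approximated \<open>P\<^sub>0\<^sup>n\<close>-almost everywhere by finite mixtures of
  product densities. Given all but one observation, such a finite mixture is a multiple of a density
  of an element of the convex hull of \<open>V\<^sub>i\<close> (no closure is needed), so integrating the observations one
  after the other produces one factor \<open>\<pi>\<close> for each of them.
\<close>

subsection \<open>Real powers on the extended half-line\<close>

text \<open>
  Here \<open>0\<^sup>0 = 0\<close>, unlike in \<^const>\<open>ennpow\<close>. This makes the power multiplicative on all of \<open>[0, \<infinity>]\<close>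
  and builds the restriction to \<open>{p > 0}\<close> into the integrand when \<open>a = 0\<close>.
\<close>

definition enn_powr :: "ennreal \<Rightarrow> real \<Rightarrow> ennreal" where
  "enn_powr t a =
     (if t = \<infinity> then (if a = 0 then 1 else \<infinity>) else ennreal (enn2real t powr a))"

lemma enn_powr_0_left [simp]: "enn_powr 0 a = 0"
  by (simp add: enn_powr_def)

lemma enn_powr_1_left [simp]: "enn_powr 1 a = 1"
  by (simp add: enn_powr_def)

lemma enn_powr_ennreal: "0 \<le> r \<Longrightarrow> enn_powr (ennreal r) a = ennreal (r powr a)"
  by (simp add: enn_powr_def)

lemma enn_powr_zero_right: "enn_powr t 0 = (if t = 0 then 0 else 1)"
  by (cases t) (auto simp: enn_powr_def)

lemma enn_powr_pos: "t \<noteq> 0 \<Longrightarrow> enn_powr t a \<noteq> 0"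
  by (cases t) (auto simp: enn_powr_def)

lemma enn_powr_mono:
  assumes "0 \<le> a" "s \<le> t"
  shows "enn_powr s a \<le> enn_powr t a"
proof (cases "t = \<infinity>")
  case True
  then show ?thesis
    using assms by (cases s) (auto simp: enn_powr_zero_right enn_powr_def)
next
  case False
  then show ?thesis
    using assms
    by (cases s; cases t) (auto simp: enn_powr_ennreal top_unique intro!: ennreal_leI powr_mono2)
qed

text \<open>Only an infinite factor needs separate care: against a zero factor both sides are
  \<open>0\<close>, and against any other factor the power of the infinite one absorbs.\<close>

lemma enn_powr_mult: "enn_powr (s * t) a = enn_powr s a * enn_powr t a"
proof -
  have *: "enn_powr (\<infinity> * t) a = enn_powr \<infinity> a * enn_powr t a" for t
    by (cases t) (auto simp: enn_powr_def ennreal_top_mult ennreal_mult_top)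
  show ?thesis
  proof (cases s; cases t)
    fix r q assume "0 \<le> r" "s = ennreal r" "0 \<le> q" "t = ennreal q"
    then show ?thesis
      by (simp add: enn_powr_ennreal powr_mult flip: ennreal_mult)
  qed (use *[of t] *[of s] in \<open>auto simp: mult.commute\<close>)
qed

text \<open>The two powers differ only at base \<open>0\<close> and exponent \<open>0\<close>, where
  \<open>ennpow\<close> is \<open>1\<close>. This direction transfers bounds to
  \<open>ratio_moment\<close>.\<close>

lemma enn_powr_le_ennpow: "enn_powr t a \<le> ennpow t a"
  by (cases t) (auto simp: enn_powr_def ennpow_def)

lemma enn_powr_eq_ennpow: "t \<noteq> 0 \<Longrightarrow> enn_powr t a = ennpow t a"
  by (cases t) (auto simp: enn_powr_def ennpow_def)

text \<open>On [0, 1] lowering a positive exponent cannot decrease the power. This is what allows an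
  exponent to be put on a posterior probability.\<close>

lemma le_enn_powr:
  assumes "0 \<le> a" "a \<le> 1" "t \<le> 1"
  shows "t \<le> enn_powr t a"
proof (cases t)
  case (real r)
  have "r \<le> r powr a"
  proof (cases "r = 0")
    case False
    then show ?thesis using real assms powr_mono'[of a 1 r] by simp
  qed simp
  then show ?thesis using real by (simp add: enn_powr_ennreal ennreal_leI)
qed (use assms in \<open>simp add: top_unique\<close>)

text \<open>The limit \<open>0\<close> is excluded because for \<open>a = 0\<close> the power is the
  indicator of the positive values, which jumps there.\<close>

lemma tendsto_enn_powr:
  assumes lim: "(f \<longlongrightarrow> t) F" and "0 \<le> a" "t \<noteq> 0"
  shows "((\<lambda>x. enn_powr (f x) a) \<longlongrightarrow> enn_powr t a) F"
proof (cases "a = 0")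
  case True
  have "eventually (\<lambda>x. f x > 0) F"
    using lim \<open>t \<noteq> 0\<close> by (intro order_tendstoD) (auto simp: zero_less_iff_neq_zero)
  then have "eventually (\<lambda>x. enn_powr t a = enn_powr (f x) a) F"
    by eventually_elim (use True \<open>t \<noteq> 0\<close> in \<open>auto simp: enn_powr_zero_right\<close>)
  then show ?thesis
    by (rule Lim_transform_eventually[OF tendsto_const])
next
  case False
  then have "a > 0" using assms by simp
  show ?thesis
  proof (cases t)
    case (real r)
    then have "r > 0" using \<open>t \<noteq> 0\<close> by (cases "r = 0") auto
    have 1: "((\<lambda>x. enn2real (f x)) \<longlongrightarrow> r) F"
      using lim real tendsto_enn2real by blast
    have "((\<lambda>x. ennreal (enn2real (f x) powr a)) \<longlongrightarrow> ennreal (r powr a)) F"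
      using 1 \<open>r > 0\<close> by (intro tendsto_ennrealI tendsto_powr) auto
    moreover have "eventually (\<lambda>x. f x < \<infinity>) F"
      using lim real by (intro order_tendstoD) auto
    then have "eventually (\<lambda>x. ennreal (enn2real (f x) powr a) = enn_powr (f x) a) F"
      by eventually_elim (auto simp: enn_powr_def)
    ultimately show ?thesis
      using real by (auto simp: enn_powr_ennreal intro: Lim_transform_eventually)
  next
    case top
    have "((\<lambda>x. enn_powr (f x) a) \<longlongrightarrow> \<infinity>) F"
      unfolding infinity_ennreal_def tendsto_top_iff_ennreal
    proof (intro allI impI)
      fix l :: real assume "0 \<le> l"
      \<comment> \<open>The threshold is chosen so that its \<open>a\<close>-th power is
        \<open>l + 1\<close>, strictly above \<open>l\<close>.\<close>
      have "eventually (\<lambda>x. f x > ennreal ((l + 1) powr (1 / a))) F"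
        using lim top by (intro order_tendstoD) auto
      then show "eventually (\<lambda>x. enn_powr (f x) a > ennreal l) F"
      proof eventually_elim
        case (elim x)
        have "ennreal l < ennreal (l + 1)" using \<open>0 \<le> l\<close> by (simp add: ennreal_less_iff)
        also have "ennreal (l + 1) = enn_powr (ennreal ((l + 1) powr (1 / a))) a"
          using \<open>a > 0\<close> \<open>0 \<le> l\<close> by (simp add: enn_powr_ennreal powr_powr)
        also have "\<dots> \<le> enn_powr (f x) a"
          using elim \<open>0 \<le> a\<close> by (intro enn_powr_mono) auto
        finally show ?case .
      qed
    qed
    then show ?thesis using top \<open>a > 0\<close> by (simp add: enn_powr_def)
  qed
qed

text \<open>Lower semicontinuity in the form used with Fatou's lemma: if \<open>t = 0\<close> or
  \<open>c = 0\<close> the left side is \<open>0\<close>, and otherwise the products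
  converge.\<close>

lemma enn_powr_le_liminf:
  fixes f :: "nat \<Rightarrow> ennreal"
  assumes "f \<longlonglongrightarrow> t" "0 \<le> a"
  shows "enn_powr t a * c \<le> liminf (\<lambda>k. enn_powr (f k) a * c)"
proof (cases "t = 0 \<or> c = 0")
  case False
  have "liminf (\<lambda>k. enn_powr (f k) a * c) = enn_powr t a * c"
    using False assms
    by (intro lim_imp_Liminf tendsto_mult_ennreal tendsto_enn_powr tendsto_const)
       (auto simp: enn_powr_pos)
  then show ?thesis by simp
qed auto

lemma measurable_enn_powr [measurable]:
  "(\<lambda>t. enn_powr t a) \<in> borel_measurable borel"
  unfolding enn_powr_def by measurable

text \<open>The tangent line of \<open>t \<mapsto> t powr (-a)\<close> at \<open>m\<close>, with the terms moved so that no subtraction occurs.\<close>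

lemma enn_powr_inverse_tangent:
  assumes "0 \<le> a" "0 < m" "t \<noteq> \<infinity>"
  shows "ennreal ((1 + a) * m powr (- a)) \<le>
    enn_powr (inverse t) a + ennreal (a * m powr (- a) / m) * t"
proof (cases t)
  case (real r)
  show ?thesis
  proof (cases "r = 0")
    case True
    have "ennreal ((1 + a) * m powr (- a)) \<le> enn_powr \<infinity> a"
      using assms by (auto simp: enn_powr_def)
    then show ?thesis using True real by simp
  next
    case False
    then have r: "r > 0" using real by simp
    \<comment> \<open>With \<open>u = r / m\<close>, the bounds \<open>ln u \<le> u - 1\<close> and
      \<open>1 + s \<le> exp s\<close> give the tangent of \<open>u powr (-a)\<close> at
      \<open>u = 1\<close>; multiplying by \<open>m powr (-a)\<close> moves it to
      \<open>m\<close>.\<close>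
    have "1 - a * (r / m - 1) \<le> 1 + (- a * ln (r / m))"
      using r assms mult_left_mono[OF ln_le_minus_one[of "r / m"], of a] by simp
    also have "\<dots> \<le> exp (- a * ln (r / m))"
      by (rule exp_ge_add_one_self)
    also have "\<dots> = (r / m) powr (- a)"
      using r assms by (simp add: powr_def)
    also have "\<dots> = r powr (- a) / m powr (- a)"
      using r assms by (simp add: powr_divide)
    finally have "(1 - a * (r / m - 1)) * m powr (- a) \<le> r powr (- a)"
      using assms by (simp add: field_simps)
    then have *: "(1 + a) * m powr (- a) \<le> r powr (- a) + a * m powr (- a) / m * r"
      by (simp add: algebra_simps)
    have "enn_powr (inverse t) a = ennreal (r powr (- a))"
      using r real by (simp add: inverse_ennreal enn_powr_ennreal powr_minus_divide powr_divide
          inverse_eq_divide)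
    then show ?thesis
      using * r real assms by (simp flip: ennreal_mult ennreal_plus add: ennreal_leI)
  qed
qed (use assms in simp)

text \<open>Jensen's inequality, by integrating the tangent at the mean \<open>m\<close>. If the
  mean is \<open>0\<close>, then \<open>f\<close> vanishes almost everywhere; if it is infinite, the
  left side is \<open>0\<close>.\<close>

lemma (in prob_space) enn_powr_inverse_nn_integral_le:
  assumes [measurable]: "f \<in> borel_measurable M" and "0 \<le> a"
  shows "enn_powr (inverse (\<integral>\<^sup>+ x. f x \<partial>M)) a \<le> (\<integral>\<^sup>+ x. enn_powr (inverse (f x)) a \<partial>M)"
proof (cases "\<integral>\<^sup>+ x. f x \<partial>M")
  case top
  then show ?thesis by simp
next
  case (real m)
  have fin: "AE x in M. f x \<noteq> \<infinity>"
    using real by (intro nn_integral_noteq_infinite) auto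
  show ?thesis
  proof (cases "m = 0")
    case True
    then have "AE x in M. f x = 0"
      using real by (simp add: nn_integral_0_iff_AE)
    then have "(\<integral>\<^sup>+ x. enn_powr (inverse (f x)) a \<partial>M) = (\<integral>\<^sup>+ x. enn_powr \<infinity> a \<partial>M)"
      by (intro nn_integral_cong_AE) auto
    then show ?thesis using True real by (simp add: emeasure_space_1)
  next
    case False
    then have m: "m > 0" using real by simp
    let ?c = "a * m powr (- a) / m"
    have "ennreal (m powr (- a)) + ennreal (a * m powr (- a)) = ennreal ((1 + a) * m powr (- a))"
      using \<open>0 \<le> a\<close> by (simp add: algebra_simps flip: ennreal_plus)
    also have "\<dots> = (\<integral>\<^sup>+ x. ennreal ((1 + a) * m powr (- a)) \<partial>M)"
      by (simp add: emeasure_space_1)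
    also have "\<dots> \<le> (\<integral>\<^sup>+ x. enn_powr (inverse (f x)) a + ennreal ?c * f x \<partial>M)"
      using fin
      by (intro nn_integral_mono_AE, eventually_elim)
         (intro enn_powr_inverse_tangent, use m \<open>0 \<le> a\<close> in auto)
    also have "\<dots> = (\<integral>\<^sup>+ x. enn_powr (inverse (f x)) a \<partial>M) + ennreal ?c * ennreal m"
      using real by (simp add: nn_integral_add nn_integral_cmult)
    also have "ennreal ?c * ennreal m = ennreal (a * m powr (- a))"
      using m \<open>0 \<le> a\<close> by (simp flip: ennreal_mult)
    \<comment> \<open>The common summand \<open>a * m powr (- a)\<close> is finite, so it can be
      cancelled.\<close>
    finally have "ennreal (m powr (- a)) \<le> (\<integral>\<^sup>+ x. enn_powr (inverse (f x)) a \<partial>M)"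
      by (subst (asm) (1 2) add.commute) (simp add: ennreal_add_left_cancel_le)
    moreover have "enn_powr (inverse (ennreal m)) a = ennreal (m powr (- a))"
      using m by (simp add: inverse_ennreal enn_powr_ennreal powr_minus_divide powr_divide
          inverse_eq_divide)
    ultimately show ?thesis using real by simp
  qed
qed

section \<open>Reciprocals and quotients on the extended half-line\<close>

lemma ennreal_inverse_antimono: "s \<le> t \<Longrightarrow> inverse t \<le> inverse (s::ennreal)"
  by (simp add: less_eq_ennreal.rep_eq inverse_ennreal.rep_eq ereal_inverse_antimono)

text \<open>Finiteness matters: for the two factors \<open>0\<close> and \<open>top\<close> the left
  side would be \<open>top\<close> and the right side \<open>0\<close>.\<close>

lemma ennreal_inverse_prod:
  "finite I \<Longrightarrow> (\<And>i. i \<in> I \<Longrightarrow> f i < \<infinity>) \<Longrightarrow>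
    inverse (\<Prod>i\<in>I. f i) = (\<Prod>i\<in>I. inverse (f i :: ennreal))"
proof (induction I rule: finite_induct)
  case (insert i I)
  then have "f i < top" "(\<Prod>i\<in>I. f i) < top"
    by (force simp: less_top[symmetric] ennreal_prod_eq_top)+
  then show ?case
    using insert by (simp add: ennreal_inverse_mult)
qed simp

lemma enn_powr_inverse:
  assumes "0 < t" "t < \<infinity>"
  shows "enn_powr (inverse t) a = inverse (ennpow t a)"
proof (cases t)
  case (real r)
  then have "r > 0" using assms by (cases "r = 0") auto
  then have "enn_powr (inverse t) a = inverse (enn_powr t a)"
    using real by (simp add: inverse_ennreal enn_powr_ennreal inverse_eq_divide powr_divide)
  then show ?thesis using assms by (simp add: enn_powr_eq_ennpow)
qed (use assms in simp)

text \<open>The quotient is at most one, so the exponent can only increase it, and so does lowering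
  the denominator from \<open>T\<close> to \<open>D\<close>. In the application these are likelihood
  integrals, \<open>T\<close> being the one over the whole model.\<close>

lemma le_enn_powr_divide:
  fixes N T D :: ennreal
  assumes "0 \<le> a" "a \<le> 1" "N \<le> T" "D \<le> T"
  shows "N / T \<le> enn_powr (N * inverse D) a"
proof -
  have "N / T \<le> 1"
    using assms by (cases "T = 0") (auto intro: divide_le_posI_ennreal simp: zero_less_iff_neq_zero)
  then have "N / T \<le> enn_powr (N / T) a"
    by (rule le_enn_powr[OF assms(1,2)])
  also have "\<dots> \<le> enn_powr (N * inverse D) a"
    using assms unfolding divide_ennreal_def
    by (intro enn_powr_mono mult_left_mono ennreal_inverse_antimono) auto
  finally show ?thesis .
qed

subsection \<open>Approximation of mixtures\<close>

text \<open>Since the deviations from the mean have mean zero under \<open>L\<close>, so has the cross term.\<close>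

lemma exists_small_increment:
  fixes f :: "'b \<Rightarrow> 'c \<Rightarrow> real"
  assumes "prob_space N" "prob_space L"
    and f [measurable]: "(\<lambda>(x, y). f x y) \<in> borel_measurable (N \<Otimes>\<^sub>M L)"
    and bound: "\<And>x y. 0 \<le> f x y" "\<And>x y. f x y \<le> M"
    and V: "AE y in L. y \<in> V"
    and g [measurable]: "g \<in> borel_measurable N" and g_bound: "\<And>x. \<bar>g x\<bar> \<le> C"
  shows "\<exists>y\<in>V \<inter> space L. (\<integral>x. (g x + (f x y - (\<integral>z. f x z \<partial>L)))\<^sup>2 \<partial>N) \<le> (\<integral>x. (g x)\<^sup>2 \<partial>N) + M\<^sup>2"
proof (rule ccontr)
  interpret N: prob_space N by fact
  interpret L: prob_space L by fact
  interpret pair_prob_space N L ..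
  define m where "m x = (\<integral>z. f x z \<partial>L)" for x
  define h where "h x y = (g x + (f x y - m x))\<^sup>2" for x y
  define c where "c = (\<integral>x. (g x)\<^sup>2 \<partial>N) + M\<^sup>2"
  assume "\<not> ?thesis"
  then have gt: "y \<in> V \<Longrightarrow> y \<in> space L \<Longrightarrow> c < (\<integral>x. h x y \<partial>N)" for y
    by (force simp: h_def m_def c_def)
  have m [measurable]: "m \<in> borel_measurable N"
    unfolding m_def by measurable
  have h [measurable]: "(\<lambda>(x, y). h x y) \<in> borel_measurable (N \<Otimes>\<^sub>M L)"
    unfolding h_def by measurable
  have fx [measurable]: "f x \<in> borel_measurable L" if "x \<in> space N" for x
    using that by measurable
  have int_f: "integrable L (f x)" if "x \<in> space N" for x
    using that bound by (intro L.integrable_const_bound[of _ M]) auto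
  have m_bound: "0 \<le> m x" "x \<in> space N \<Longrightarrow> m x \<le> M" for x
    using bound int_f L.integral_le_const[of "f x" M] by (auto simp: m_def)
  have d_bound: "\<bar>f x y - m x\<bar> \<le> M" if "x \<in> space N" for x y
    using m_bound[of x] bound(1)[of x y] bound(2)[of x y] that by auto
  have h_bound: "norm (h x y) \<le> (C + M)\<^sup>2" if "x \<in> space N" for x y
  proof -
    have "\<bar>g x + (f x y - m x)\<bar> \<le> C + M"
      using g_bound[of x] d_bound[OF that, of y] by linarith
    then have "\<bar>g x + (f x y - m x)\<bar>\<^sup>2 \<le> (C + M)\<^sup>2"
      by (intro power_mono) auto
    then show ?thesis by (simp add: h_def)
  qed
  have int_h: "integrable (N \<Otimes>\<^sub>M L) (\<lambda>(x, y). h x y)"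
    using h_bound by (intro P.integrable_const_bound[of _ "(C + M)\<^sup>2"])
      (auto simp: space_pair_measure intro!: AE_I2)
  have int_g: "integrable N (\<lambda>x. (g x)\<^sup>2)"
  proof (intro N.integrable_const_bound[of _ "C\<^sup>2"] AE_I2)
    show "norm ((g x)\<^sup>2) \<le> C\<^sup>2" for x
      using power_mono[OF g_bound[of x], of 2] by simp
  qed simp
  have inner: "(\<integral>y. h x y \<partial>L) \<le> (g x)\<^sup>2 + M\<^sup>2" if x: "x \<in> space N" for x
  proof -
    have sq: "(f x y - m x)\<^sup>2 \<le> M\<^sup>2" for y
      using power_mono[OF d_bound[OF x, of y], of 2] by simp
    have i2: "integrable L (\<lambda>y. (f x y - m x)\<^sup>2)"
      using sq x by (intro L.integrable_const_bound[of _ "M\<^sup>2"]) auto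
    have "(\<integral>y. h x y \<partial>L) = (\<integral>y. (g x)\<^sup>2 + (2 * g x * (f x y - m x) + (f x y - m x)\<^sup>2) \<partial>L)"
      by (intro Bochner_Integration.integral_cong) (auto simp: h_def power2_sum)
    also have "\<dots> = (g x)\<^sup>2 + (2 * g x * ((\<integral>y. f x y \<partial>L) - m x) + (\<integral>y. (f x y - m x)\<^sup>2 \<partial>L))"
      using int_f[OF x] i2 by (simp add: L.prob_space)
    also have "\<dots> \<le> (g x)\<^sup>2 + M\<^sup>2"
      using L.integral_le_const[OF i2, of "M\<^sup>2"] sq by (simp add: m_def)
    finally show ?thesis .
  qed
  \<comment> \<open>If every point of \<open>V\<close> exceeded the bound \<open>c\<close>, so would
    the average over \<open>L\<close>; integrating in the other order shows that this average is at
    most \<open>c\<close>.\<close>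
  have "c < (\<integral>y. (\<integral>x. h x y \<partial>N) \<partial>L)"
  proof (rule L.expectation_greater)
    show "integrable L (\<lambda>y. \<integral>x. h x y \<partial>N)"
      using integrable_snd[OF int_h] by simp
    show "AE y in L. c < (\<integral>x. h x y \<partial>N)"
      using V AE_space by eventually_elim (rule gt)
  qed
  also have "\<dots> = (\<integral>x. (\<integral>y. h x y \<partial>L) \<partial>N)"
    using Fubini_integral[OF int_h] .
  also have "\<dots> \<le> (\<integral>x. (g x)\<^sup>2 + M\<^sup>2 \<partial>N)"
    using integrable_fst[OF int_h] int_g inner by (intro integral_mono) auto
  also have "\<dots> = c"
    using int_g by (simp add: c_def N.prob_space)
  finally show False by simp
qed

text \<open>
  A strong law for bounded functions without independence: the points are chosen one after the
  other so that the \<open>L\<^sup>2\<close> norm of the \<open>k\<close>-th partial sum of deviations is at most \<open>M * sqrt k\<close>. Along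
  the squares the means then converge almost everywhere.
\<close>

lemma exists_empirical_means_converging:
  fixes f :: "'b \<Rightarrow> 'c \<Rightarrow> real"
  assumes N: "prob_space N" and L: "prob_space L"
    and f [measurable]: "(\<lambda>(x, y). f x y) \<in> borel_measurable (N \<Otimes>\<^sub>M L)"
    and bound: "\<And>x y. 0 \<le> f x y" "\<And>x y. f x y \<le> M"
    and V: "AE y in L. y \<in> V"
  obtains Y :: "nat \<Rightarrow> 'c" where "\<And>j. Y j \<in> V \<inter> space L"
    and "AE x in N. (\<lambda>k. (\<Sum>j<(Suc k)\<^sup>2. f x (Y j)) / real ((Suc k)\<^sup>2)) \<longlonglongrightarrow> (\<integral>y. f x y \<partial>L)"
proof -
  interpret N: prob_space N by fact
  interpret L: prob_space L by fact
  define m where "m x = (\<integral>z. f x z \<partial>L)" for x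
  define good where "good g y \<longleftrightarrow> y \<in> V \<inter> space L \<and>
    (\<integral>x. (g x + (f x y - m x))\<^sup>2 \<partial>N) \<le> (\<integral>x. (g x)\<^sup>2 \<partial>N) + M\<^sup>2" for g y
  define choose_next where "choose_next g = (SOME y. good g y)" for g
  \<comment> \<open>The partial sums are set to \<open>0\<close> outside \<open>space N\<close>: the
    selection step asks for a bound at every point, while \<open>m x \<le> M\<close> is available
    only on \<open>space N\<close>.\<close>
  define S where "S = rec_nat (\<lambda>x. 0)
    (\<lambda>_ g x. if x \<in> space N then g x + (f x (choose_next g) - m x) else 0)"
  define Y where "Y j = choose_next (S j)" for j
  have S_0: "S 0 = (\<lambda>x. 0)"
    by (simp add: S_def)
  have S_Suc: "S (Suc j) = (\<lambda>x. if x \<in> space N then S j x + (f x (Y j) - m x) else 0)" for j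
    unfolding S_def Y_def by (simp only: old.nat.simps(7))
  have m [measurable]: "m \<in> borel_measurable N"
    unfolding m_def by measurable
  have M: "0 \<le> M" using order_trans[OF bound] .
  have m_bound: "0 \<le> m x" "x \<in> space N \<Longrightarrow> m x \<le> M" for x
  proof -
    show "0 \<le> m x" using bound by (simp add: m_def)
    assume x: "x \<in> space N"
    have [measurable]: "f x \<in> borel_measurable L" using x by measurable
    have "integrable L (f x)"
      using bound by (intro L.integrable_const_bound[of _ M]) auto
    then show "m x \<le> M" using bound L.integral_le_const[of "f x" M] by (auto simp: m_def)
  qed
  have step: "\<exists>y. good g y" if "g \<in> borel_measurable N" "\<And>x. \<bar>g x\<bar> \<le> C" for g C
    using exists_small_increment[OF N L f bound V that] by (auto simp: good_def m_def)
  \<comment> \<open>The last clause concerns \<open>Y (j - 1)\<close> because that point is chosen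
    in passing from \<open>S (j - 1)\<close> to \<open>S j\<close>.\<close>
  have inv: "S j \<in> borel_measurable N \<and> (\<forall>x. \<bar>S j x\<bar> \<le> j * M) \<and> (\<integral>x. (S j x)\<^sup>2 \<partial>N) \<le> j * M\<^sup>2
      \<and> (j > 0 \<longrightarrow> Y (j - 1) \<in> V \<inter> space L)" for j
  proof (induction j)
    case 0
    then show ?case by (simp add: S_0)
  next
    case (Suc j)
    then have S [measurable]: "S j \<in> borel_measurable N"
      and S_bound: "\<bar>S j x\<bar> \<le> j * M"
      and S_sq: "(\<integral>x. (S j x)\<^sup>2 \<partial>N) \<le> j * M\<^sup>2" for x
      by blast+
    have "\<exists>y. good (S j) y"
      using S S_bound by (rule step)
    then have "good (S j) (Y j)"
      unfolding Y_def choose_next_def by (rule someI_ex)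
    then have Y: "Y j \<in> V \<inter> space L"
      and le: "(\<integral>x. (S j x + (f x (Y j) - m x))\<^sup>2 \<partial>N) \<le> (\<integral>x. (S j x)\<^sup>2 \<partial>N) + M\<^sup>2"
      by (simp_all add: good_def)
    have [measurable]: "(\<lambda>x. f x (Y j)) \<in> borel_measurable N"
      using Y by simp
    have "S (Suc j) \<in> borel_measurable N"
      unfolding S_Suc by measurable
    moreover have "\<bar>S (Suc j) x\<bar> \<le> Suc j * M" for x
    proof (cases "x \<in> space N")
      case True
      have "\<bar>S j x + (f x (Y j) - m x)\<bar> \<le> j * M + M"
        using S_bound[of x] m_bound(1)[of x] m_bound(2)[OF True]
          bound(1)[of x "Y j"] bound(2)[of x "Y j"] by linarith
      then show ?thesis using True by (simp add: S_Suc algebra_simps)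
    qed (use M in \<open>simp add: S_Suc\<close>)
    moreover have "(\<integral>x. (S (Suc j) x)\<^sup>2 \<partial>N) \<le> Suc j * M\<^sup>2"
    proof -
      have "(\<integral>x. (S (Suc j) x)\<^sup>2 \<partial>N) = (\<integral>x. (S j x + (f x (Y j) - m x))\<^sup>2 \<partial>N)"
        by (rule Bochner_Integration.integral_cong) (simp_all add: S_Suc)
      then show ?thesis using le S_sq by (simp add: distrib_right)
    qed
    ultimately show ?case
      using Y by simp
  qed
  have S_measurable [measurable]: "S j \<in> borel_measurable N" for j
    using inv[of j] by simp
  have S_int: "integrable N (\<lambda>x. (S j x)\<^sup>2)" for j
  proof (intro N.integrable_const_bound[of _ "(j * M)\<^sup>2"] AE_I2)
    show "norm ((S j x)\<^sup>2) \<le> (j * M)\<^sup>2" for x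
      using power_mono[of "\<bar>S j x\<bar>" "j * M" 2] inv[of j] by simp
  qed simp
  have S_eq: "S j x = (\<Sum>i<j. f x (Y i)) - j * m x" if "x \<in> space N" for j x
    using that by (induction j) (auto simp: S_0 S_Suc algebra_simps)
  \<comment> \<open>After \<open>r\<close> terms the mean deviation has second moment at most
    \<open>M\<^sup>2 / r\<close>. For \<open>r = (Suc k)\<^sup>2\<close> these bounds are summable
    in \<open>k\<close>, which forces \<open>D k x\<close> to tend to \<open>0\<close> almost
    everywhere.\<close>
  define D where "D k x = S ((Suc k)\<^sup>2) x / real ((Suc k)\<^sup>2)" for k x
  have [measurable]: "D k \<in> borel_measurable N" for k
    unfolding D_def by measurable
  have D: "(\<integral>\<^sup>+x. ennreal ((D k x)\<^sup>2) \<partial>N) \<le> ennreal (M\<^sup>2 * (1 / (real (Suc k))\<^sup>2))" for k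
  proof -
    define r where "r = real ((Suc k)\<^sup>2)"
    have r: "r > 0" by (simp add: r_def)
    have "(\<integral>\<^sup>+x. ennreal ((D k x)\<^sup>2) \<partial>N) = ennreal (\<integral>x. (D k x)\<^sup>2 \<partial>N)"
      using S_int[of "(Suc k)\<^sup>2"] unfolding D_def power_divide
      by (intro nn_integral_eq_integral) auto
    also have "(\<integral>x. (D k x)\<^sup>2 \<partial>N) = (\<integral>x. (S ((Suc k)\<^sup>2) x)\<^sup>2 \<partial>N) / r\<^sup>2"
      unfolding D_def power_divide r_def by simp
    also have "\<dots> \<le> r * M\<^sup>2 / r\<^sup>2"
      using inv[of "(Suc k)\<^sup>2"] by (intro divide_right_mono) (auto simp: r_def)
    also have "\<dots> = M\<^sup>2 * (1 / r)" using r by (simp add: power2_eq_square)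
    finally show ?thesis by (simp add: r_def ennreal_leI)
  qed
  have summ: "summable (\<lambda>k. M\<^sup>2 * (1 / (real (Suc k))\<^sup>2))"
    using inverse_squares_sums by (intro summable_mult) (auto simp: sums_iff add.commute)
  have "(\<integral>\<^sup>+x. (\<Sum>k. ennreal ((D k x)\<^sup>2)) \<partial>N) = (\<Sum>k. \<integral>\<^sup>+x. ennreal ((D k x)\<^sup>2) \<partial>N)"
    by (intro nn_integral_suminf) simp
  also have "\<dots> \<le> (\<Sum>k. ennreal (M\<^sup>2 * (1 / (real (Suc k))\<^sup>2)))"
    by (intro suminf_le D) auto
  also have "\<dots> < \<infinity>"
    by (subst suminf_ennreal2[OF _ summ]) auto
  finally have "AE x in N. (\<Sum>k. ennreal ((D k x)\<^sup>2)) \<noteq> \<infinity>"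
    by (intro nn_integral_noteq_infinite) auto
  then have "AE x in N. (\<lambda>k. (\<Sum>j<(Suc k)\<^sup>2. f x (Y j)) / real ((Suc k)\<^sup>2)) \<longlonglongrightarrow> m x"
    using AE_space
  proof eventually_elim
    case (elim x)
    then have "summable (\<lambda>k. (D k x)\<^sup>2)"
      by (intro summable_suminf_not_top) auto
    then have "(\<lambda>k. sqrt ((D k x)\<^sup>2)) \<longlonglongrightarrow> sqrt 0"
      by (intro tendsto_real_sqrt summable_LIMSEQ_zero)
    then have "(\<lambda>k. D k x) \<longlonglongrightarrow> 0"
      by (simp add: tendsto_rabs_zero_iff)
    moreover have "D k x = (\<Sum>j<(Suc k)\<^sup>2. f x (Y j)) / real ((Suc k)\<^sup>2) - m x" for k
      using elim by (simp only: D_def S_eq) (simp add: field_simps)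
    ultimately show ?case
      by (simp add: LIM_zero_iff)
  qed
  moreover have "Y j \<in> V \<inter> space L" for j
    using inv[of "Suc j"] by simp
  ultimately show ?thesis
    using that[of Y] by (simp add: m_def)
qed

text \<open>
  Weights need not sum to one: integrating out the last coordinate \<open>y\<close> first replaces the weights
  \<open>w j\<close> by \<open>w j * f j y\<close>, so the hypothesis about one coordinate applies at every step.
\<close>

lemma nn_integral_enn_powr_product_mixture_le:
  fixes f :: "nat \<Rightarrow> 'a \<Rightarrow> ennreal"
  assumes N: "prob_space N"
    and f: "\<And>j. j < k \<Longrightarrow> f j \<in> borel_measurable N" "\<And>j. j < k \<Longrightarrow> AE y in N. f j y < \<infinity>"
    and g [measurable]: "g \<in> borel_measurable N"
    and one: "\<And>w. (\<And>j. j < k \<Longrightarrow> w j < \<infinity>) \<Longrightarrow>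
      (\<integral>\<^sup>+ y. enn_powr ((\<Sum>j<k. w j * f j y) * g y) a \<partial>N) \<le> enn_powr (\<Sum>j<k. w j) a * s"
    and w: "\<And>j. j < k \<Longrightarrow> w j < \<infinity>"
  shows "(\<integral>\<^sup>+ x. enn_powr ((\<Sum>j<k. w j * (\<Prod>i<n. f j (x i))) * (\<Prod>i<n. g (x i))) a
      \<partial>iid_product n N) \<le> enn_powr (\<Sum>j<k. w j) a * s ^ n"
  using w
proof (induction n arbitrary: w)
  case 0
  then show ?case by (simp add: iid_product_def space_PiM_empty)
next
  case (Suc n)
  interpret N: prob_space N by fact
  interpret product_sigma_finite "\<lambda>_::nat. N" ..
  note f(1) [measurable]
  let ?G = "\<lambda>n w x. enn_powr ((\<Sum>j<k. w j * (\<Prod>i<n. f j (x i))) * (\<Prod>i<n. g (x i))) a"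
  have [measurable]: "?G n w \<in> borel_measurable (PiM {..<n} (\<lambda>_. N))" for n and w :: "nat \<Rightarrow> ennreal"
    by measurable
  have "(\<integral>\<^sup>+ x. ?G (Suc n) w x \<partial>iid_product (Suc n) N) =
      (\<integral>\<^sup>+ y. (\<integral>\<^sup>+ x. ?G (Suc n) w (x(n := y)) \<partial>iid_product n N) \<partial>N)"
    unfolding iid_product_def lessThan_Suc by (intro product_nn_integral_insert_rev) simp_all
  also have "\<dots> = (\<integral>\<^sup>+ y. (\<integral>\<^sup>+ x. ?G n (\<lambda>j. w j * f j y) x \<partial>iid_product n N) * enn_powr (g y) a \<partial>N)"
  proof (intro nn_integral_cong)
    fix y
    have "?G (Suc n) w (x(n := y)) = ?G n (\<lambda>j. w j * f j y) x * enn_powr (g y) a" for x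
      by (simp add: mult_ac flip: enn_powr_mult)
    then show "(\<integral>\<^sup>+ x. ?G (Suc n) w (x(n := y)) \<partial>iid_product n N) =
        (\<integral>\<^sup>+ x. ?G n (\<lambda>j. w j * f j y) x \<partial>iid_product n N) * enn_powr (g y) a"
      unfolding iid_product_def by (simp add: nn_integral_multc)
  qed
  also have "\<dots> \<le> (\<integral>\<^sup>+ y. enn_powr (\<Sum>j<k. w j * f j y) a * s ^ n * enn_powr (g y) a \<partial>N)"
  proof (rule nn_integral_mono_AE)
    \<comment> \<open>The induction hypothesis requires finite weights, and the new weights
      \<open>w j * f j y\<close> are finite only for almost every \<open>y\<close>.\<close>
    have "AE y in N. \<forall>j<k. f j y < \<infinity>"
      using f(2) by (simp add: AE_all_countable)
    then show "AE y in N. (\<integral>\<^sup>+ x. ?G n (\<lambda>j. w j * f j y) x \<partial>iid_product n N) * enn_powr (g y) a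
        \<le> enn_powr (\<Sum>j<k. w j * f j y) a * s ^ n * enn_powr (g y) a"
    proof eventually_elim
      case (elim y)
      then show ?case
        using Suc.prems
        by (intro mult_right_mono Suc.IH) (auto simp: ennreal_mult_less_top)
    qed
  qed
  also have "\<dots> = (\<integral>\<^sup>+ y. s ^ n * enn_powr ((\<Sum>j<k. w j * f j y) * g y) a \<partial>N)"
    by (simp add: enn_powr_mult mult_ac)
  also have "\<dots> = s ^ n * (\<integral>\<^sup>+ y. enn_powr ((\<Sum>j<k. w j * f j y) * g y) a \<partial>N)"
    by (intro nn_integral_cmult) measurable
  also have "\<dots> \<le> s ^ n * (enn_powr (\<Sum>j<k. w j) a * s)"
    using Suc.prems by (intro mult_left_mono one) auto
  finally show ?case by (simp add: mult_ac)
qed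

text \<open>
  A general mixture is approximated by finite ones. Truncation at a level \<open>b\<close> makes the integrand
  bounded, and Fatou's lemma gives the inequality for every \<open>b\<close>.
\<close>

lemma nn_integral_enn_powr_mixture_le:
  fixes F :: "'b \<Rightarrow> 'c \<Rightarrow> ennreal"
  assumes N: "prob_space N" and L: "prob_space L"
    and F [measurable]: "(\<lambda>(x, y). F x y) \<in> borel_measurable (N \<Otimes>\<^sub>M L)"
    and c [measurable]: "c \<in> borel_measurable N" and "0 \<le> a"
    and V: "AE y in L. y \<in> V"
    and finite_mixture: "\<And>k Y. k > 0 \<Longrightarrow> (\<And>j. Y j \<in> V \<inter> space L) \<Longrightarrow>
      (\<integral>\<^sup>+ x. enn_powr (\<Sum>j<k. ennreal (1 / real k) * F x (Y j)) a * c x \<partial>N) \<le> s"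
  shows "(\<integral>\<^sup>+ x. enn_powr (\<integral>\<^sup>+ y. F x y \<partial>L) a * c x \<partial>N) \<le> s"
proof -
  interpret N: prob_space N by fact
  interpret L: prob_space L by fact
  have Fx [measurable]: "F x \<in> borel_measurable L" if "x \<in> space N" for x
    using that by measurable
  have truncated: "(\<integral>\<^sup>+ x. enn_powr (\<integral>\<^sup>+ y. min (F x y) (of_nat b) \<partial>L) a * c x \<partial>N) \<le> s" for b
  proof -
    \<comment> \<open>The truncated function is finite, so it can be made real-valued for the law on
      empirical means.\<close>
    define f where "f x y = enn2real (min (F x y) (of_nat b))" for x y
    have f [measurable]: "(\<lambda>(x, y). f x y) \<in> borel_measurable (N \<Otimes>\<^sub>M L)"
      unfolding f_def by measurable
    have f_eq: "ennreal (f x y) = min (F x y) (of_nat b)" for x y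
    proof -
      have "min (F x y) (of_nat b) < top"
        by (rule le_less_trans[OF min.cobounded2 of_nat_less_top])
      then show ?thesis by (simp add: f_def)
    qed
    have f_bound: "0 \<le> f x y" "f x y \<le> real b" for x y
    proof -
      show "0 \<le> f x y" by (simp add: f_def)
      have "ennreal (f x y) \<le> ennreal (real b)"
        by (simp add: f_eq ennreal_of_nat_eq_real_of_nat)
      then show "f x y \<le> real b" by simp
    qed
    obtain Y where Y: "\<And>j. Y j \<in> V \<inter> space L"
      and lim: "AE x in N. (\<lambda>k. (\<Sum>j<(Suc k)\<^sup>2. f x (Y j)) / real ((Suc k)\<^sup>2)) \<longlonglongrightarrow> (\<integral>y. f x y \<partial>L)"
      using exists_empirical_means_converging[OF N L f f_bound V] by blast
    define A where "A k x = (\<Sum>j<(Suc k)\<^sup>2. f x (Y j)) / real ((Suc k)\<^sup>2)" for k x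
    have [measurable]: "(\<lambda>x. f x (Y j)) \<in> borel_measurable N" for j
      using Y[of j] by simp
    have [measurable]: "A k \<in> borel_measurable N" for k
      unfolding A_def by measurable
    have "(\<integral>\<^sup>+ x. enn_powr (\<integral>\<^sup>+ y. min (F x y) (of_nat b) \<partial>L) a * c x \<partial>N)
        \<le> (\<integral>\<^sup>+ x. liminf (\<lambda>k. enn_powr (ennreal (A k x)) a * c x) \<partial>N)"
    proof (rule nn_integral_mono_AE)
      show "AE x in N. enn_powr (\<integral>\<^sup>+ y. min (F x y) (of_nat b) \<partial>L) a * c x
          \<le> liminf (\<lambda>k. enn_powr (ennreal (A k x)) a * c x)"
        using lim AE_space
      proof eventually_elim
        case (elim x)
        have [measurable]: "f x \<in> borel_measurable L" using elim by measurable
        have "integrable L (f x)"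
          using f_bound by (intro L.integrable_const_bound[of _ "real b"]) auto
        then have "(\<integral>\<^sup>+ y. min (F x y) (of_nat b) \<partial>L) = ennreal (\<integral>y. f x y \<partial>L)"
          using f_bound by (simp add: nn_integral_eq_integral flip: f_eq)
        moreover have "(\<lambda>k. ennreal (A k x)) \<longlonglongrightarrow> ennreal (\<integral>y. f x y \<partial>L)"
          using elim by (intro tendsto_ennrealI) (simp add: A_def)
        ultimately show ?case
          using \<open>0 \<le> a\<close> by (simp add: enn_powr_le_liminf)
      qed
    qed
    also have "\<dots> \<le> liminf (\<lambda>k. \<integral>\<^sup>+ x. enn_powr (ennreal (A k x)) a * c x \<partial>N)"
      by (intro nn_integral_liminf) measurable
    also have "\<dots> \<le> liminf (\<lambda>k::nat. s)"
    proof (intro Liminf_mono always_eventually allI)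
      fix k
      \<comment> \<open>Dropping the truncation only enlarges the empirical mean, and the result is
        a finite mixture to which \<open>finite_mixture\<close> applies.\<close>
      have "ennreal (A k x) \<le> (\<Sum>j<(Suc k)\<^sup>2. ennreal (1 / real ((Suc k)\<^sup>2)) * F x (Y j))" for x
      proof -
        have "ennreal (A k x) = (\<Sum>j<(Suc k)\<^sup>2. ennreal (1 / real ((Suc k)\<^sup>2) * f x (Y j)))"
          using f_bound by (subst sum_ennreal) (auto simp: A_def sum_divide_distrib)
        also have "\<dots> \<le> (\<Sum>j<(Suc k)\<^sup>2. ennreal (1 / real ((Suc k)\<^sup>2)) * F x (Y j))"
          using f_bound
          by (intro sum_mono, subst ennreal_mult) (auto simp: f_eq intro!: mult_left_mono)
        finally show ?thesis .
      qed
      then have "(\<integral>\<^sup>+ x. enn_powr (ennreal (A k x)) a * c x \<partial>N) \<le>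
          (\<integral>\<^sup>+ x. enn_powr (\<Sum>j<(Suc k)\<^sup>2. ennreal (1 / real ((Suc k)\<^sup>2)) * F x (Y j)) a * c x \<partial>N)"
        using \<open>0 \<le> a\<close> by (intro nn_integral_mono mult_right_mono enn_powr_mono) auto
      also have "\<dots> \<le> s"
        using Y by (intro finite_mixture) auto
      finally show "(\<integral>\<^sup>+ x. enn_powr (ennreal (A k x)) a * c x \<partial>N) \<le> s" .
    qed
    finally show ?thesis by (simp add: Liminf_const)
  qed
  \<comment> \<open>Monotone convergence of the truncated mixtures and a second use of Fatou's lemma
    remove the level \<open>b\<close>.\<close>
  have "(\<integral>\<^sup>+ x. enn_powr (\<integral>\<^sup>+ y. F x y \<partial>L) a * c x \<partial>N)
      \<le> (\<integral>\<^sup>+ x. liminf (\<lambda>b. enn_powr (\<integral>\<^sup>+ y. min (F x y) (of_nat b) \<partial>L) a * c x) \<partial>N)"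
  proof (intro nn_integral_mono enn_powr_le_liminf)
    fix x assume x [measurable]: "x \<in> space N"
    show "(\<lambda>b. \<integral>\<^sup>+ y. min (F x y) (of_nat b) \<partial>L) \<longlonglongrightarrow> (\<integral>\<^sup>+ y. F x y \<partial>L)"
    proof (rule nn_integral_LIMSEQ)
      show "incseq (\<lambda>b y. min (F x y) (of_nat b))"
        by (auto simp: incseq_def le_fun_def intro!: min.mono simp del: min.bounded_iff)
      fix y
      have "(\<lambda>b. min (F x y) (of_nat b)) \<longlonglongrightarrow> min (F x y) top"
        by (intro tendsto_min tendsto_const of_nat_tendsto_top_ennreal)
      then show "(\<lambda>b. min (F x y) (of_nat b)) \<longlonglongrightarrow> F x y" by simp
    qed measurable
  qed (rule \<open>0 \<le> a\<close>)
  also have "\<dots> \<le> liminf (\<lambda>b. \<integral>\<^sup>+ x. enn_powr (\<integral>\<^sup>+ y. min (F x y) (of_nat b) \<partial>L) a * c x \<partial>N)"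
    by (intro nn_integral_liminf) measurable
  also have "\<dots> \<le> liminf (\<lambda>b::nat. s)"
    using truncated by (intro Liminf_mono always_eventually allI)
  finally show ?thesis by (simp add: Liminf_const)
qed

subsection \<open>Dominated models\<close>

text \<open>A \<mu>-null set \<open>A\<close> is null for every \<open>P\<close> in the model, so
  the event that a single observation falls in \<open>A\<close> has predictive mass zero. Statements
  that hold \<mu>-almost everywhere then carry over to \<open>P0\<close>.\<close>

lemma absolutely_continuous_of_prior_predictive:
  assumes "dominated_model \<mu> prior p" and P0: "prob_space P0" "sets P0 = sets \<mu>"
    and ac: "absolutely_continuous (prior_predictive \<mu> prior 1) (iid_product 1 P0)"
  shows "absolutely_continuous \<mu> P0"
  unfolding absolutely_continuous_def
proof
  interpret dominated_model \<mu> prior p by fact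
  fix A assume A: "A \<in> null_sets \<mu>"
  then have [measurable]: "A \<in> sets \<mu>" by auto
  define C where "C = Pi\<^sub>E {..<1::nat} (\<lambda>_. A)"
  have C: "emeasure (iid_product 1 P) C = emeasure P A" if "prob_space P" "sets P = sets \<mu>" for P
  proof -
    interpret prob_space P by fact
    interpret product_sigma_finite "\<lambda>_::nat. P" ..
    show ?thesis
      using that by (simp add: C_def iid_product_def emeasure_PiM del: One_nat_def)
  qed
  have sets_C: "C \<in> sets (iid_product 1 P)" if "sets P = sets \<mu>" for P
    using that unfolding C_def iid_product_def by (intro sets_PiM_I_finite) auto
  have "emeasure P A = 0" if P: "P \<in> space prior" for P
  proof -
    have "A \<in> null_sets (density \<mu> (p P))"
      using A P measurable_Pair2'[of P prior \<mu>] density_measurable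
      by (intro absolutely_continuousI_density[unfolded absolutely_continuous_def, THEN subsetD])
         (auto intro: measurable_compose)
    then show ?thesis using model_density[OF P] by auto
  qed
  then have "(\<integral>\<^sup>+ P. emeasure (iid_product 1 P) C \<partial>prior) = 0"
    using model_prob_space model_sets
    by (subst nn_integral_cong[of prior _ "\<lambda>_. 0"]) (auto simp: C simp del: One_nat_def)
  \<comment> \<open>The measure built by \<open>measure_of\<close> gives \<open>C\<close> either the
    stated integral or the default value \<open>0\<close>; \<open>C\<close> is null in both cases,
    so countable additivity need not be shown.\<close>
  then have "C \<in> null_sets (prior_predictive \<mu> prior 1)"
    using sets_C[of \<mu>] sets.space_closed[of "iid_product 1 \<mu>"]
    by (auto simp: null_sets_def prior_predictive_def emeasure_measure_of_conv
        sets.sets_measure_of_eq simp del: One_nat_def)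
  then have "C \<in> null_sets (iid_product 1 P0)"
    using ac by (auto simp: absolutely_continuous_def)
  then show "A \<in> null_sets P0"
    using C[OF P0] P0 by (auto simp: null_sets_def simp del: One_nat_def)
qed

context dominated_model
begin

section \<open>Densities and moments for one observation\<close>

lemma p_measurable [measurable]: "P \<in> space prior \<Longrightarrow> p P \<in> borel_measurable \<mu>"
  using measurable_compose[OF measurable_Pair2' density_measurable] by simp

lemma AE_p_finite: "P \<in> space prior \<Longrightarrow> AE x in \<mu>. p P x < \<infinity>"
proof -
  assume P: "P \<in> space prior"
  then interpret prob_space P by (rule model_prob_space)
  have "(\<integral>\<^sup>+ x. p P x \<partial>\<mu>) = emeasure (density \<mu> (p P)) (space \<mu>)"
    using P by (simp add: emeasure_density cong: nn_integral_cong)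
  also have "\<dots> = 1"
    using emeasure_space_1 sets_eq_imp_space_eq[OF model_sets[OF P]] model_density[OF P] by simp
  finally have "AE x in \<mu>. p P x \<noteq> \<infinity>"
    using P by (intro nn_integral_noteq_infinite) auto
  then show ?thesis
    by eventually_elim (simp add: less_top)
qed

text \<open>The densities agree with the Radon-Nikodym derivatives \<mu>-almost everywhere, hence
  \<open>P0\<close>-almost everywhere, and the derivative of \<open>P0\<close> is positive there.
  Points with \<open>r x = 0\<close> contribute nothing on the left, even for
  \<open>a = 0\<close>.\<close>

lemma ratio_moment_ge:
  assumes ac: "absolutely_continuous \<mu> P0" and P0: "sets P0 = sets \<mu>"
    and r: "r \<in> borel_measurable \<mu>" "density \<mu> r = R"
    and q: "q \<in> borel_measurable \<mu>" "density \<mu> q = Q"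
  shows "(\<integral>\<^sup>+ x. enn_powr (r x * inverse (q x)) a \<partial>P0) \<le> ratio_moment \<mu> P0 R Q a"
  unfolding ratio_moment_def
proof (rule nn_integral_mono_AE)
  have "AE x in density \<mu> (RN_deriv \<mu> P0). RN_deriv \<mu> P0 x > 0"
    by (simp add: AE_density)
  then have "AE x in P0. RN_deriv \<mu> P0 x > 0"
    unfolding \<mu>.density_RN_deriv[OF ac P0] .
  moreover have "AE x in P0. r x = RN_deriv \<mu> R x"
    by (rule absolutely_continuous_AE[OF P0 ac \<mu>.RN_deriv_unique[OF r]])
  moreover have "AE x in P0. q x = RN_deriv \<mu> Q x"
    by (rule absolutely_continuous_AE[OF P0 ac \<mu>.RN_deriv_unique[OF q]])
  ultimately show "AE x in P0. enn_powr (r x * inverse (q x)) a \<le>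
      ennpow (RN_deriv \<mu> R x / RN_deriv \<mu> Q x) a *
      indicator {x \<in> space \<mu>. RN_deriv \<mu> P0 x > 0 \<and> RN_deriv \<mu> R x > 0} x"
    using AE_space
  proof eventually_elim
    case (elim x)
    then show ?case
      using enn_powr_le_ennpow[of "r x * inverse (q x)" a] sets_eq_imp_space_eq[OF P0]
      by (cases "r x = 0") (auto simp: divide_ennreal_def zero_less_iff_neq_zero)
  qed
qed

text \<open>Dividing the weights by their total \<open>t\<close> turns the mixture into
  \<open>t\<close> times the density \<open>r\<close> of an element \<open>R\<close> of the hull.
  The power of \<open>t\<close> factors out and the remaining integral is at most the supremum. For
  total weight zero both sides vanish.\<close>

lemma mixture_moment_le:
  fixes k :: nat
  assumes ac: "absolutely_continuous \<mu> P0" and P0: "sets P0 = sets \<mu>"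
    and P: "\<And>j. j < k \<Longrightarrow> P j \<in> W" "W \<subseteq> space prior" and Q: "Q \<in> B" "Q \<in> space prior"
    and w: "\<And>j. j < k \<Longrightarrow> w j < \<infinity>"
  shows "(\<integral>\<^sup>+ y. enn_powr ((\<Sum>j<k. w j * p (P j) y) * inverse (p Q y)) a \<partial>P0) \<le>
    enn_powr (\<Sum>j<k. w j) a * pi_sup \<mu> P0 (co \<mu> W) B a"
proof (cases "(\<Sum>j<k. w j) = 0")
  case True
  then have "w j = 0" if "j < k" for j
    using that by (simp add: sum_eq_0_iff)
  then show ?thesis by simp
next
  case False
  have P_space: "P j \<in> space prior" if "j < k" for j
    using P(1)[OF that] P(2) by (rule subsetD[rotated])
  have [measurable]: "p (P j) \<in> borel_measurable P0" if "j < k" for j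
    using p_measurable[OF P_space[OF that]]
    by (simp add: measurable_cong_sets[OF P0 refl])
  have [measurable]: "p Q \<in> borel_measurable P0"
    using p_measurable[OF Q(2)] by (simp add: measurable_cong_sets[OF P0 refl])
  define w' where "w' j = enn2real (w j)" for j
  define t where "t = (\<Sum>j<k. w' j)"
  define v where "v j = w' j / t" for j
  define r where "r y = (\<Sum>j<k. ennreal (v j) * p (P j) y)" for y
  define R where "R = density \<mu> r"
  have w_eq: "w j = ennreal (w' j)" if "j < k" for j
    using w[OF that] by (simp add: w'_def)
  have w'_nonneg: "0 \<le> w' j" for j
    by (simp add: w'_def)
  have "(\<Sum>j<k. w j) = (\<Sum>j<k. ennreal (w' j))"
    using w_eq by (intro sum.cong) auto
  then have sum_w: "(\<Sum>j<k. w j) = ennreal t"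
    using w'_nonneg by (simp add: t_def)
  have t: "t > 0"
  proof -
    have "t \<noteq> 0" using False sum_w by auto
    moreover have "t \<ge> 0" unfolding t_def by (intro sum_nonneg w'_nonneg)
    ultimately show ?thesis by simp
  qed
  have w_v: "w j = ennreal t * ennreal (v j)" if "j < k" for j
    using w_eq[OF that] t w'_nonneg[of j] by (simp add: v_def flip: ennreal_mult)
  have [measurable]: "p (P j) \<in> borel_measurable \<mu>" if "j < k" for j
    using that by (intro p_measurable P_space)
  have r [measurable]: "r \<in> borel_measurable \<mu>"
    unfolding r_def by measurable
  have "R \<in> co \<mu> W"
    unfolding co_def
  proof (intro CollectI conjI exI)
    show "sets R = sets \<mu>" by (simp add: R_def)
    show "\<forall>j<k. P j \<in> W \<and> 0 \<le> v j"
      using P t w'_nonneg by (auto simp: v_def)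
    show "(\<Sum>j<k. v j) = 1"
      using t by (simp add: v_def t_def flip: sum_divide_distrib)
    show "\<forall>A\<in>sets \<mu>. emeasure R A = (\<Sum>j<k. ennreal (v j) * emeasure (P j) A)"
    proof
      fix A assume [measurable]: "A \<in> sets \<mu>"
      have "emeasure R A = (\<integral>\<^sup>+ x. (\<Sum>j<k. ennreal (v j) * (p (P j) x * indicator A x)) \<partial>\<mu>)"
        by (simp add: R_def emeasure_density) (simp add: r_def sum_distrib_right mult.assoc)
      also have "\<dots> = (\<Sum>j<k. \<integral>\<^sup>+ x. ennreal (v j) * (p (P j) x * indicator A x) \<partial>\<mu>)"
        by (intro nn_integral_sum) auto
      also have "\<dots> = (\<Sum>j<k. ennreal (v j) * emeasure (density \<mu> (p (P j))) A)"
        by (intro sum.cong refl) (simp add: emeasure_density nn_integral_cmult)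
      also have "\<dots> = (\<Sum>j<k. ennreal (v j) * emeasure (P j) A)"
        by (intro sum.cong) (simp_all add: model_density P_space)
      finally show "emeasure R A = (\<Sum>j<k. ennreal (v j) * emeasure (P j) A)" .
    qed
  qed
  then have sup: "ratio_moment \<mu> P0 R Q a \<le> pi_sup \<mu> P0 (co \<mu> W) B a"
    unfolding pi_sup_def using Q(1) by (intro SUP_upper2[of R] SUP_upper)
  have [measurable]: "r \<in> borel_measurable P0"
    using r by (simp add: measurable_cong_sets[OF P0 refl])
  have "(\<integral>\<^sup>+ y. enn_powr ((\<Sum>j<k. w j * p (P j) y) * inverse (p Q y)) a \<partial>P0) =
      (\<integral>\<^sup>+ y. enn_powr (ennreal t) a * enn_powr (r y * inverse (p Q y)) a \<partial>P0)"
  proof (intro nn_integral_cong)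
    fix y
    have "(\<Sum>j<k. w j * p (P j) y) = ennreal t * r y"
      by (simp add: w_v r_def mult.assoc sum_distrib_left)
    then show "enn_powr ((\<Sum>j<k. w j * p (P j) y) * inverse (p Q y)) a =
        enn_powr (ennreal t) a * enn_powr (r y * inverse (p Q y)) a"
      by (simp add: mult.assoc flip: enn_powr_mult)
  qed
  also have "\<dots> = enn_powr (ennreal t) a * (\<integral>\<^sup>+ y. enn_powr (r y * inverse (p Q y)) a \<partial>P0)"
    by (intro nn_integral_cmult) measurable
  also have "\<dots> \<le> enn_powr (ennreal t) a * pi_sup \<mu> P0 (co \<mu> W) B a"
    using Q p_measurable[OF Q(2)] model_density[OF Q(2)]
    by (intro mult_left_mono order_trans[OF ratio_moment_ge[OF ac P0 r R_def[symmetric]] sup])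
      auto
  finally show ?thesis by (simp add: sum_w)
qed

section \<open>Likelihoods of several observations\<close>

lemma likelihood_measurable:
  assumes P0: "sets P0 = sets \<mu>"
  shows "(\<lambda>(x, P). \<Prod>i<n. p P (x i)) \<in> borel_measurable (iid_product n P0 \<Otimes>\<^sub>M prior)"
proof -
  have "(\<lambda>z. p (snd z) (fst z i)) \<in> borel_measurable (iid_product n P0 \<Otimes>\<^sub>M prior)" if "i < n" for i
  proof -
    have "(\<lambda>z. fst z i) \<in> measurable (iid_product n P0 \<Otimes>\<^sub>M prior) P0"
      using that unfolding iid_product_def
      by (intro measurable_compose[OF measurable_fst measurable_component_singleton]) auto
    then have "(\<lambda>z. (fst z i, snd z)) \<in> measurable (iid_product n P0 \<Otimes>\<^sub>M prior) (\<mu> \<Otimes>\<^sub>M prior)"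
      by (intro measurable_Pair measurable_snd) (simp_all add: measurable_cong_sets[OF refl P0])
    from measurable_compose[OF this density_measurable] show ?thesis by simp
  qed
  then show ?thesis
    by (simp add: case_prod_beta')
qed

text \<open>For fixed \<open>Q\<close>, each finite mixture over \<open>W\<close> obeys the
  one-observation bound coordinate by coordinate; the normalised prior on \<open>W\<close> is then
  reached by approximation.\<close>

lemma likelihood_ratio_moment_le:
  assumes ac: "absolutely_continuous \<mu> P0" and P0: "prob_space P0" "sets P0 = sets \<mu>"
    and W: "W \<in> sets prior" "emeasure prior W \<noteq> 0" and Q: "Q \<in> B" "Q \<in> space prior" and "0 \<le> a"
  shows "(\<integral>\<^sup>+ x. enn_powr (\<integral>\<^sup>+ P. (\<Prod>i<n. p P (x i)) \<partial>uniform_measure prior W) a *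
      enn_powr (inverse (\<Prod>i<n. p Q (x i))) a \<partial>iid_product n P0) \<le> pi_sup \<mu> P0 (co \<mu> W) B a ^ n"
proof -
  let ?s = "pi_sup \<mu> P0 (co \<mu> W) B a"
  let ?F = "\<lambda>x P. \<Prod>i<n. p P (x i)"
  interpret P0: prob_space P0 by fact
  have N: "prob_space (iid_product n P0)"
    unfolding iid_product_def by (intro prob_space_PiM P0)
  have p_P0: "p P \<in> borel_measurable P0" if "P \<in> space prior" for P
    using p_measurable[OF that] by (simp add: measurable_cong_sets[OF P0(2) refl])
  have W_space: "W \<subseteq> space prior" using W by (auto dest: sets.sets_into_space)
  have AE_P0: "AE y in P0. p P y < \<infinity>" if "P \<in> space prior" for P
    using absolutely_continuous_AE[OF P0(2) ac AE_p_finite[OF that]] .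
  have F: "(\<lambda>(x, P). ?F x P) \<in> borel_measurable (iid_product n P0 \<Otimes>\<^sub>M prior)"
    by (rule likelihood_measurable[OF P0(2)])
  have F_Q: "(\<lambda>x. ?F x Q) \<in> borel_measurable (iid_product n P0)"
    using measurable_compose[OF measurable_Pair2'[OF Q(2)] F] by simp
  \<comment> \<open>Splitting the reciprocal of the likelihood needs finite factors, which almost
    every sample provides.\<close>
  have AE_Q: "AE x in iid_product n P0. inverse (?F x Q) = (\<Prod>i<n. inverse (p Q (x i)))"
  proof -
    have "AE x in iid_product n P0. \<forall>i\<in>{..<n}. p Q (x i) < \<infinity>"
      unfolding iid_product_def
      by (intro AE_finite_allI AE_PiM_component AE_P0 Q P0) auto
    then show ?thesis
      by eventually_elim (auto intro!: ennreal_inverse_prod)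
  qed
  show ?thesis
  proof (rule nn_integral_enn_powr_mixture_le[OF N, where V = W])
    show "prob_space (uniform_measure prior W)"
      using W by (intro prob_space_uniform_measure) auto
    show "(\<lambda>(x, P). ?F x P) \<in> borel_measurable (iid_product n P0 \<Otimes>\<^sub>M uniform_measure prior W)"
      using F by (simp add: measurable_cong_sets[OF sets_pair_measure_cong[OF refl sets_uniform_measure] refl])
    show "(\<lambda>x. enn_powr (inverse (?F x Q)) a) \<in> borel_measurable (iid_product n P0)"
      using F_Q by measurable
    show "AE P in uniform_measure prior W. P \<in> W"
      using W by (intro AE_uniform_measureI) auto
    fix k :: nat and Y :: "nat \<Rightarrow> 'a measure"
    assume k: "k > 0" and Y: "\<And>j. Y j \<in> W \<inter> space (uniform_measure prior W)"
    let ?w = "\<lambda>j::nat. ennreal (1 / real k)"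
    have sum_w: "(\<Sum>j<k. ?w j) = 1"
      using k by (simp add: ennreal_of_nat_eq_real_of_nat flip: ennreal_mult)
    have "(\<integral>\<^sup>+ x. enn_powr (\<Sum>j<k. ?w j * ?F x (Y j)) a * enn_powr (inverse (?F x Q)) a \<partial>iid_product n P0) =
        (\<integral>\<^sup>+ x. enn_powr ((\<Sum>j<k. ?w j * ?F x (Y j)) * (\<Prod>i<n. inverse (p Q (x i)))) a \<partial>iid_product n P0)"
      using AE_Q by (intro nn_integral_cong_AE) (auto simp: enn_powr_mult)
    also have "\<dots> \<le> enn_powr (\<Sum>j<k. ?w j) a * ?s ^ n"
    proof (rule nn_integral_enn_powr_product_mixture_le[OF P0(1)])
      have Y': "Y j \<in> space prior" for j using Y[of j] by simp
      show "p (Y j) \<in> borel_measurable P0" "AE y in P0. p (Y j) y < \<infinity>" for j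
        using p_P0[OF Y'] AE_P0[OF Y'] by auto
      show "(\<lambda>y. inverse (p Q y)) \<in> borel_measurable P0"
        using p_P0[OF Q(2)] by measurable
      show "(\<integral>\<^sup>+ y. enn_powr ((\<Sum>j<k. w j * p (Y j) y) * inverse (p Q y)) a \<partial>P0) \<le>
          enn_powr (\<Sum>j<k. w j) a * ?s" if "\<And>j. j < k \<Longrightarrow> w j < \<infinity>" for w
        using Y by (intro mixture_moment_le[OF ac P0(2) _ W_space Q that]) auto
    qed auto
    finally show "(\<integral>\<^sup>+ x. enn_powr (\<Sum>j<k. ?w j * ?F x (Y j)) a *
        enn_powr (inverse (?F x Q)) a \<partial>iid_product n P0) \<le> ?s ^ n"
      by (simp only: sum_w enn_powr_1_left mult_1)
  qed fact
qed

section \<open>Bounds on the expected posterior mass\<close>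

lemma posterior_measurable:
  assumes P0: "sets P0 = sets \<mu>" and W [measurable]: "W \<in> sets prior"
  shows "posterior prior p n W \<in> borel_measurable (iid_product n P0)"
proof -
  note likelihood_measurable[OF P0, measurable]
  show ?thesis unfolding posterior_def by measurable
qed

text \<open>Each likelihood integral is a prior mass times an average over a normalised restriction
  of the prior, \<open>L\<close> for \<open>W\<close> and \<open>K\<close> for \<open>B\<close>; the
  masses produce the factor \<open>c\<close>. A null set \<open>W\<close> has no such restriction,
  but its posterior mass is zero.\<close>

lemma posterior_expectation_le:
  assumes ac: "absolutely_continuous \<mu> P0" and P0: "prob_space P0" "sets P0 = sets \<mu>"
    and W [measurable]: "W \<in> sets prior" and B [measurable]: "B \<in> sets prior"
    and B_pos: "emeasure prior B \<noteq> 0"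
    and a: "0 \<le> a" "a \<le> 1"
  shows "(\<integral>\<^sup>+ x. posterior prior p n W x \<partial>iid_product n P0) \<le>
    ennpow (emeasure prior W) a / ennpow (emeasure prior B) a * pi_sup \<mu> P0 (co \<mu> W) B a ^ n"
proof (cases "emeasure prior W = 0")
  case True
  then have "AE P in prior. P \<notin> W"
    using W by (intro AE_not_in) auto
  then have "(\<integral>\<^sup>+ P\<in>W. (\<Prod>i<n. p P (x i)) \<partial>prior) = (\<integral>\<^sup>+ P. 0 \<partial>prior)" for x
    by (intro nn_integral_cong_AE) auto
  then show ?thesis by (simp add: posterior_def)
next
  case False
  let ?N = "iid_product n P0" and ?F = "\<lambda>x P. \<Prod>i<n. p P (x i)"
  let ?s = "pi_sup \<mu> P0 (co \<mu> W) B a"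
  define L where "L = uniform_measure prior W"
  define K where "K = uniform_measure prior B"
  have sets_eq [measurable_cong]: "sets L = sets prior" "sets K = sets prior"
    by (simp_all add: L_def K_def)
  interpret L: prob_space L
    unfolding L_def using False by (intro prob_space_uniform_measure) auto
  interpret K: prob_space K
    unfolding K_def using B_pos by (intro prob_space_uniform_measure) auto
  interpret N: prob_space ?N
    unfolding iid_product_def by (intro prob_space_PiM P0)
  interpret NK: pair_sigma_finite ?N K ..
  note likelihood_measurable[OF P0(2), of n, measurable]
  have F_x [measurable]: "?F x \<in> borel_measurable prior" if "x \<in> space ?N" for x
    using measurable_compose[OF measurable_Pair1'[OF that] likelihood_measurable[OF P0(2)]] that
    by simp
  define c where "c = ennpow (emeasure prior W) a / ennpow (emeasure prior B) a"
  have mass: "(\<integral>\<^sup>+ P\<in>A. ?F x P \<partial>prior) = emeasure prior A * (\<integral>\<^sup>+ P. ?F x P \<partial>uniform_measure prior A)"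
    if [measurable]: "A \<in> sets prior" and "emeasure prior A \<noteq> 0" "x \<in> space ?N" for A x
    using that
    by (subst nn_integral_uniform_measure)
      (auto simp: ennreal_times_divide mult.commute[of "emeasure prior A"] mult_divide_eq_ennreal)
  \<comment> \<open>Both masses are positive and finite, where \<open>enn_powr\<close> and
    \<open>ennpow\<close> agree.\<close>
  have c: "enn_powr (emeasure prior W) a * enn_powr (inverse (emeasure prior B)) a = c"
    using False B_pos
    by (subst enn_powr_inverse) (auto simp: c_def enn_powr_eq_ennpow divide_ennreal_def
        zero_less_iff_neq_zero less_top[symmetric])
  have bound: "posterior prior p n W x \<le>
      c * (\<integral>\<^sup>+ Q. enn_powr (\<integral>\<^sup>+ P. ?F x P \<partial>L) a * enn_powr (inverse (?F x Q)) a \<partial>K)"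
    if x: "x \<in> space ?N" for x
  proof -
    note [measurable] = F_x[OF x]
    let ?b = "emeasure prior B"
    have inverse_mass: "inverse (?b * (\<integral>\<^sup>+ Q. ?F x Q \<partial>K)) = inverse ?b * inverse (\<integral>\<^sup>+ Q. ?F x Q \<partial>K)"
      using B_pos by (intro ennreal_inverse_mult') (auto simp: zero_less_iff_neq_zero less_top[symmetric])
    have "posterior prior p n W x \<le>
        enn_powr ((\<integral>\<^sup>+ P\<in>W. ?F x P \<partial>prior) * inverse (\<integral>\<^sup>+ P\<in>B. ?F x P \<partial>prior)) a"
      unfolding posterior_def
      by (intro le_enn_powr_divide a nn_integral_mono) (auto simp: indicator_def)
    also have "\<dots> = c * (enn_powr (\<integral>\<^sup>+ P. ?F x P \<partial>L) a * enn_powr (inverse (\<integral>\<^sup>+ Q. ?F x Q \<partial>K)) a)"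
      using mass[OF W False x] mass[OF B B_pos x]
      by (simp add: inverse_mass enn_powr_mult mult_ac flip: L_def K_def c)
    \<comment> \<open>Jensen's inequality under \<open>K\<close> moves the average over
      \<open>B\<close> out of the power.\<close>
    also have "\<dots> \<le> c * (enn_powr (\<integral>\<^sup>+ P. ?F x P \<partial>L) a * (\<integral>\<^sup>+ Q. enn_powr (inverse (?F x Q)) a \<partial>K))"
      using a by (intro mult_left_mono K.enn_powr_inverse_nn_integral_le) auto
    also have "\<dots> = c * (\<integral>\<^sup>+ Q. enn_powr (\<integral>\<^sup>+ P. ?F x P \<partial>L) a * enn_powr (inverse (?F x Q)) a \<partial>K)"
      by (subst nn_integral_cmult) auto
    finally show ?thesis .
  qed
  have "(\<integral>\<^sup>+ x. posterior prior p n W x \<partial>?N) \<le>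
      (\<integral>\<^sup>+ x. c * (\<integral>\<^sup>+ Q. enn_powr (\<integral>\<^sup>+ P. ?F x P \<partial>L) a * enn_powr (inverse (?F x Q)) a \<partial>K) \<partial>?N)"
    by (intro nn_integral_mono bound)
  also have "\<dots> = c * (\<integral>\<^sup>+ x. (\<integral>\<^sup>+ Q. enn_powr (\<integral>\<^sup>+ P. ?F x P \<partial>L) a * enn_powr (inverse (?F x Q)) a \<partial>K) \<partial>?N)"
    by (intro nn_integral_cmult) measurable
  \<comment> \<open>After the exchange \<open>Q\<close> is fixed in the inner integral, so the
    moment bound applies for each \<open>Q\<close> in \<open>B\<close>, and \<open>K\<close> is
    concentrated on \<open>B\<close>.\<close>
  also have "(\<integral>\<^sup>+ x. (\<integral>\<^sup>+ Q. enn_powr (\<integral>\<^sup>+ P. ?F x P \<partial>L) a * enn_powr (inverse (?F x Q)) a \<partial>K) \<partial>?N) =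
      (\<integral>\<^sup>+ Q. (\<integral>\<^sup>+ x. enn_powr (\<integral>\<^sup>+ P. ?F x P \<partial>L) a * enn_powr (inverse (?F x Q)) a \<partial>?N) \<partial>K)"
    by (intro NK.Fubini'[symmetric]) measurable
  also have "\<dots> \<le> (\<integral>\<^sup>+ Q. ?s ^ n \<partial>K)"
  proof (rule nn_integral_mono_AE)
    have "AE Q in K. Q \<in> B"
      unfolding K_def by (intro AE_uniform_measureI) auto
    then show "AE Q in K. (\<integral>\<^sup>+ x. enn_powr (\<integral>\<^sup>+ P. ?F x P \<partial>L) a *
        enn_powr (inverse (?F x Q)) a \<partial>?N) \<le> ?s ^ n"
      using AE_space
    proof eventually_elim
      case (elim Q)
      then show ?case
        unfolding L_def
        by (intro likelihood_ratio_moment_le[OF ac P0 W False]) (auto simp: K_def a)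
    qed
  qed
  also have "\<dots> = ?s ^ n"
    by (simp add: K.emeasure_space_1)
  finally show ?thesis by (simp add: c_def mult_left_mono)
qed

text \<open>The denominator does not depend on the set, and the indicator of \<open>V\<close> is at
  most the sum of the indicators of the cover.\<close>

lemma posterior_le_suminf:
  assumes "V \<subseteq> (\<Union>i. Vs i)" and [measurable]: "\<And>i::nat. Vs i \<in> sets prior"
    and P0: "sets P0 = sets \<mu>" and x: "x \<in> space (iid_product n P0)"
  shows "posterior prior p n V x \<le> (\<Sum>i. posterior prior p n (Vs i) x)"
proof -
  let ?F = "\<lambda>P. \<Prod>i<n. p P (x i)"
  have [measurable]: "?F \<in> borel_measurable prior"
    using measurable_compose[OF measurable_Pair1'[OF x] likelihood_measurable[OF P0]] by simp
  have "(\<integral>\<^sup>+ P\<in>V. ?F P \<partial>prior) \<le> (\<integral>\<^sup>+ P. (\<Sum>i. ?F P * indicator (Vs i) P) \<partial>prior)"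
  proof (rule nn_integral_mono)
    fix P
    show "?F P * indicator V P \<le> (\<Sum>i. ?F P * indicator (Vs i) P)"
    proof (cases "P \<in> V")
      case True
      then obtain i where "P \<in> Vs i" using assms(1) by auto
      then have "?F P = (\<Sum>j\<in>{i}. ?F P * indicator (Vs j) P)" by simp
      also have "\<dots> \<le> (\<Sum>i. ?F P * indicator (Vs i) P)"
        by (intro sum_le_suminf) auto
      finally show ?thesis using True by simp
    qed simp
  qed
  also have "\<dots> = (\<Sum>i. \<integral>\<^sup>+ P\<in>Vs i. ?F P \<partial>prior)"
    by (intro nn_integral_suminf) measurable
  finally show ?thesis
    unfolding posterior_def by (simp add: divide_right_mono_ennreal)
qed

end

theorem theorem4p3:
  fixes \<mu> P0 :: "'a measure"
    and prior :: "'a measure measure"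
    and p :: "'a measure \<Rightarrow> 'a \<Rightarrow> ennreal"
    and V :: "'a measure set"
    and Vs Bs :: "nat \<Rightarrow> 'a measure set"
    and n :: nat
  assumes "dominated_model \<mu> prior p"
    and "prob_space P0" and "sets P0 = sets \<mu>"
    and "\<And>m. m \<ge> 1 \<Longrightarrow> absolutely_continuous (prior_predictive \<mu> prior m) (iid_product m P0)"
    and "V \<in> sets prior"
    and "\<And>i. Vs i \<in> sets prior" and "V \<subseteq> (\<Union>i. Vs i)"
    and "\<And>i. Bs i \<in> sets prior" and "\<And>i. measure prior (Bs i) > 0"
    and "\<And>i P. P \<in> Vs i \<Longrightarrow> (SUP Q\<in>Bs i. ratio_moment \<mu> P0 P Q 1) < \<infinity>"
    and "n \<ge> 1"
  shows "(\<integral>\<^sup>+ x. posterior prior p n V x \<partial>iid_product n P0)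
    \<le> (\<Sum>i. INF \<alpha>\<in>{0..1::real}.
          ennpow (emeasure prior (Vs i)) \<alpha> / ennpow (emeasure prior (Bs i)) \<alpha>
            * pi_sup \<mu> P0 (co \<mu> (Vs i)) (Bs i) \<alpha> ^ n)"
proof -
  interpret dominated_model \<mu> prior p by fact
  have ac: "absolutely_continuous \<mu> P0"
    using assms(1-3) assms(4)[of 1] by (rule absolutely_continuous_of_prior_predictive) simp
  have B: "emeasure prior (Bs i) \<noteq> 0" for i
    using assms(9)[of i] by (auto simp: measure_def)
  have "(\<integral>\<^sup>+ x. posterior prior p n V x \<partial>iid_product n P0) \<le>
      (\<integral>\<^sup>+ x. (\<Sum>i. posterior prior p n (Vs i) x) \<partial>iid_product n P0)"
    using assms by (intro nn_integral_mono posterior_le_suminf) auto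
  also have "\<dots> = (\<Sum>i. \<integral>\<^sup>+ x. posterior prior p n (Vs i) x \<partial>iid_product n P0)"
    using assms by (intro nn_integral_suminf posterior_measurable)
  also have "\<dots> \<le> (\<Sum>i. INF \<alpha>\<in>{0..1::real}.
          ennpow (emeasure prior (Vs i)) \<alpha> / ennpow (emeasure prior (Bs i)) \<alpha>
            * pi_sup \<mu> P0 (co \<mu> (Vs i)) (Bs i) \<alpha> ^ n)"
    \<comment> \<open>The bound holds for each \<open>i\<close> and each exponent separately, so the
      infimum may be taken inside the sum.\<close>
    by (intro suminf_le INF_greatest posterior_expectation_le ac assms B) auto
  finally show ?thesis .
qed

end
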